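(* Let $V_0,V_1$ be finite-dimensional super vector spaces of the same parity $p\in\mathbb Z/2\mathbb Z$, in duality via a fixed perfect pairing, and consider the second-order operator $\Delta=\sum_{i,j}I^{ij}\partial_{v^0_i}\partial_{v^1_j}$ acting on a supercommutative algebra built from dual bases $\{v^0_i\}\subset V_0^*$, $\{v^1_j\}\subset V_1^*$. (1) If $v^0_i$ and $v^1_j$ are assigned the same parity $p$ (i.e. the algebra is $A(V_0)\otimes A(V_1)$ with $A=\bigwedge^\bullet$ if $p$ is odd and $A=\mathrm{Sym}$ if $p$ is even, applied identically to both factors), then $\Delta^2\neq0$ in general as soon as $\dim V_0=\dim V_1\ge2$. (2) If instead $v^1_j$ is assigned the opposite parity $p+1$ (i.e. the algebra is $A_p(V_0)\otimes A_{p+1}(V_1)$, with $A_{\mathrm{odd}}=\bigwedge^\bullet$, $A_{\mathrm{even}}=\mathrm{Sym}$), then $\Delta^2=0$ identically.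
   Context: Super vector spaces are $\mathbb Z/2\mathbb Z$-graded complex vector spaces with the Koszul sign rule. $I^{ij}$ are the entries of the inverse of the matrix of the perfect pairing between $V_0$ and $V_1$ in the chosen bases (an invertible matrix). $\partial_v$ is the graded derivation dual to the generator $v$ (Grassmann/odd if $v$ is odd, ordinary/even if $v$ is even). "$\Delta^2\ne0$ in general" means that the identity $\Delta^2=0$ does not hold in general. *)

theory Defs
  imports
    "HOL-Library.Poly_Mapping"
    "HOL-Library.Z2"
    "Jordan_Normal_Form.Matrix"
begin

section \<open>Free supercommutative algebras\<close>

text \<open>
  Parities are elements of the field \<^typ>\<open>bit\<close> with two elements.  A family of generators is a set
  \<open>X\<close> of a linearly ordered type together with a parity function \<open>\<pi>\<close>.  The free supercommutative
  complex algebra on it has as basis the ordered monomials, encoded by their exponents: an even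
  generator has an arbitrary exponent, an odd generator has exponent at most 1.  Thus it is
  \<open>Sym\<close> if all generators are even, the exterior algebra if all are odd, and, if all elements of
  \<open>X\<close> precede all elements of \<open>Y\<close>, the algebra on \<open>X \<union> Y\<close> is the graded tensor product of those
  on \<open>X\<close> and \<open>Y\<close>.
\<close>

type_synonym 'x salg = "('x \<Rightarrow>\<^sub>0 nat) \<Rightarrow>\<^sub>0 complex"

definition monomials :: "('x \<Rightarrow> bit) \<Rightarrow> 'x set \<Rightarrow> ('x \<Rightarrow>\<^sub>0 nat) set" where
  "monomials \<pi> X =
    {m. Poly_Mapping.keys m \<subseteq> X \<and> (\<forall>x. \<pi> x = 1 \<longrightarrow> Poly_Mapping.lookup m x \<le> 1)}"

definition salg :: "('x \<Rightarrow> bit) \<Rightarrow> 'x set \<Rightarrow> 'x salg set" where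
  "salg \<pi> X = {a. Poly_Mapping.keys a \<subseteq> monomials \<pi> X}"

definition scale :: "complex \<Rightarrow> 'x salg \<Rightarrow> 'x salg" where
  "scale c a = Poly_Mapping.map ((*) c) a"

definition gen :: "'x \<Rightarrow> 'x salg" where
  "gen x = Poly_Mapping.single (Poly_Mapping.single x 1) 1"

definition ksign :: "bit \<Rightarrow> complex" where
  "ksign r = (if r = 1 then - 1 else 1)"

definition odd_degree :: "('x \<Rightarrow> bit) \<Rightarrow> ('x \<Rightarrow>\<^sub>0 nat) \<Rightarrow> nat" where
  "odd_degree \<pi> m = (\<Sum>x\<in>Poly_Mapping.keys m. if \<pi> x = 1 then Poly_Mapping.lookup m x else 0)"

definition homogeneous :: "('x \<Rightarrow> bit) \<Rightarrow> bit \<Rightarrow> 'x salg \<Rightarrow> bool" where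
  "homogeneous \<pi> r a \<longleftrightarrow> (\<forall>m\<in>Poly_Mapping.keys a. of_nat (odd_degree \<pi> m) = r)"

text \<open>The number of transpositions of odd generators needed to order the word \<open>m m'\<close>.\<close>

definition swaps :: "('x::linorder \<Rightarrow> bit) \<Rightarrow> ('x \<Rightarrow>\<^sub>0 nat) \<Rightarrow> ('x \<Rightarrow>\<^sub>0 nat) \<Rightarrow> nat" where
  "swaps \<pi> m m' =
    (\<Sum>x\<in>Poly_Mapping.keys m. \<Sum>y\<in>Poly_Mapping.keys m'.
       if y < x \<and> \<pi> x = 1 \<and> \<pi> y = 1
       then Poly_Mapping.lookup m x * Poly_Mapping.lookup m' y else 0)"

definition mon_coeff :: "('x::linorder \<Rightarrow> bit) \<Rightarrow> ('x \<Rightarrow>\<^sub>0 nat) \<Rightarrow> ('x \<Rightarrow>\<^sub>0 nat) \<Rightarrow> complex" where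
  "mon_coeff \<pi> m m' = (if m + m' \<in> monomials \<pi> UNIV then (- 1) ^ swaps \<pi> m m' else 0)"

definition sprod :: "('x::linorder \<Rightarrow> bit) \<Rightarrow> 'x salg \<Rightarrow> 'x salg \<Rightarrow> 'x salg" where
  "sprod \<pi> a b =
    (\<Sum>m\<in>Poly_Mapping.keys a. \<Sum>m'\<in>Poly_Mapping.keys b.
       Poly_Mapping.single (m + m')
         (mon_coeff \<pi> m m' * Poly_Mapping.lookup a m * Poly_Mapping.lookup b m'))"

definition graded_derivation ::
  "('x::linorder \<Rightarrow> bit) \<Rightarrow> 'x set \<Rightarrow> bit \<Rightarrow> ('x salg \<Rightarrow> 'x salg) \<Rightarrow> bool" where
  "graded_derivation \<pi> X d D \<longleftrightarrow>
    (\<forall>a\<in>salg \<pi> X. D a \<in> salg \<pi> X) \<and>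
    (\<forall>a\<in>salg \<pi> X. \<forall>b\<in>salg \<pi> X. D (a + b) = D a + D b) \<and>
    (\<forall>c. \<forall>a\<in>salg \<pi> X. D (scale c a) = scale c (D a)) \<and>
    (\<forall>r. \<forall>a\<in>salg \<pi> X. homogeneous \<pi> r a \<longrightarrow> homogeneous \<pi> (r + d) (D a)) \<and>
    (\<forall>r. \<forall>a\<in>salg \<pi> X. \<forall>b\<in>salg \<pi> X. homogeneous \<pi> r a \<longrightarrow>
       D (sprod \<pi> a b) = sprod \<pi> (D a) b + scale (ksign (d * r)) (sprod \<pi> a (D b)))"

definition dual_derivation ::
  "('x::linorder \<Rightarrow> bit) \<Rightarrow> 'x set \<Rightarrow> 'x \<Rightarrow> ('x salg \<Rightarrow> 'x salg) \<Rightarrow> bool" where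
  "dual_derivation \<pi> X x D \<longleftrightarrow>
    graded_derivation \<pi> X (\<pi> x) D \<and> (\<forall>y\<in>X. D (gen y) = (if y = x then 1 else 0))"

text \<open>
  The graded derivation dual to the generator \<open>x\<close>.  It exists, and is unique as an operator on
  \<^term>\<open>salg \<pi> X\<close>: see \<open>dual_derivation_partial\<close> and \<open>dual_derivation_unique\<close> below.
\<close>

definition partial ::
  "('x::linorder \<Rightarrow> bit) \<Rightarrow> 'x set \<Rightarrow> 'x \<Rightarrow> 'x salg \<Rightarrow> 'x salg" where
  "partial \<pi> X x = (SOME D. dual_derivation \<pi> X x D)"


subsection \<open>The algebra laws\<close>

abbreviation "lk \<equiv> Poly_Mapping.lookup"
abbreviation "ks \<equiv> Poly_Mapping.keys"
abbreviation "sg \<equiv> Poly_Mapping.single"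

lemma neg_one_square [simp]: "(- 1) ^ k * (- 1) ^ k = (1::complex)" "(- 1) ^ k * ((- 1) ^ k * z) = (z::complex)"
  by (metis minus_one_mult_self, metis minus_one_mult_self mult.assoc mult_1)

lemma of_nat_bit_odd: "(of_nat k :: bit) = 1 \<longleftrightarrow> odd k"
  by (metis bit_not_zero_iff even_of_nat even_zero odd_one)

lemma ksign_of_nat: "ksign (of_nat k) = (- 1) ^ k"
  by (simp add: ksign_def of_nat_bit_odd)

lemma ksign_of_nat_mult: "ksign (of_nat j * of_nat k) = (- 1) ^ (j * k)"
  by (metis ksign_of_nat of_nat_mult)

lemma ksign_0 [simp]: "ksign 0 = 1"
  by (simp add: ksign_def)

lemma lookup_scale [simp]: "lk (scale c a) m = c * lk a m"
  unfolding scale_def by (simp add: map.rep_eq when_def)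

lemma swaps_superset:
  assumes "finite S" "ks m \<subseteq> S" "finite T" "ks m' \<subseteq> T"
  shows "swaps \<pi> m m' = (\<Sum>x\<in>S. \<Sum>y\<in>T. if y < x \<and> \<pi> x = 1 \<and> \<pi> y = 1 then lk m x * lk m' y else 0)"
proof -
  have "swaps \<pi> m m' = (\<Sum>x\<in>ks m. \<Sum>y\<in>T. if y < x \<and> \<pi> x = 1 \<and> \<pi> y = 1 then lk m x * lk m' y else 0)"
    unfolding swaps_def
    by (intro sum.cong refl sum.mono_neutral_left assms) (auto simp: in_keys_iff)
  also have "\<dots> = (\<Sum>x\<in>S. \<Sum>y\<in>T. if y < x \<and> \<pi> x = 1 \<and> \<pi> y = 1 then lk m x * lk m' y else 0)"
    by (intro sum.mono_neutral_left assms) (auto simp: in_keys_iff intro!: sum.neutral)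
  finally show ?thesis .
qed

lemma swaps_add_left: "swaps \<pi> (m + n) m' = swaps \<pi> m m' + swaps \<pi> n m'"
proof -
  let ?S = "ks m \<union> ks n" let ?T = "ks m'"
  have *: "finite ?S" "ks (m+n) \<subseteq> ?S" "finite ?T" "ks m \<subseteq> ?S" "ks n \<subseteq> ?S" "ks m' \<subseteq> ?T"
    using Poly_Mapping.keys_add[of m n] by auto
  show ?thesis
    unfolding swaps_superset[OF *(1,2,3,6)] swaps_superset[OF *(1,4,3,6)] swaps_superset[OF *(1,5,3,6)]
    unfolding sum.distrib[symmetric] by (intro sum.cong refl) (simp add: lookup_add algebra_simps)
qed

lemma swaps_add_right: "swaps \<pi> m' (m + n) = swaps \<pi> m' m + swaps \<pi> m' n"
proof -
  let ?S = "ks m \<union> ks n" let ?T = "ks m'"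
  have *: "finite ?S" "ks (m+n) \<subseteq> ?S" "finite ?T" "ks m \<subseteq> ?S" "ks n \<subseteq> ?S" "ks m' \<subseteq> ?T"
    using Poly_Mapping.keys_add[of m n] by auto
  show ?thesis
    unfolding swaps_superset[OF *(3,6,1,2)] swaps_superset[OF *(3,6,1,4)] swaps_superset[OF *(3,6,1,5)]
    unfolding sum.distrib[symmetric] by (intro sum.cong refl) (simp add: lookup_add algebra_simps)
qed

lemma swaps_zero [simp]: "swaps \<pi> 0 m = 0" "swaps \<pi> m 0 = 0"
  by (simp_all add: swaps_def)

lemma odd_degree_superset:
  assumes "finite S" "ks m \<subseteq> S"
  shows "odd_degree \<pi> m = (\<Sum>x\<in>S. if \<pi> x = 1 then lk m x else 0)"
  unfolding odd_degree_def
  by (intro sum.mono_neutral_left assms) (auto simp: in_keys_iff)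

lemma odd_degree_add: "odd_degree \<pi> (m + n) = odd_degree \<pi> m + odd_degree \<pi> n"
proof -
  let ?S = "ks m \<union> ks n"
  have *: "finite ?S" "ks (m+n) \<subseteq> ?S" "ks m \<subseteq> ?S" "ks n \<subseteq> ?S"
    using Poly_Mapping.keys_add[of m n] by auto
  show ?thesis
    unfolding odd_degree_superset[OF *(1,2)] odd_degree_superset[OF *(1,3)] odd_degree_superset[OF *(1,4)]
    unfolding sum.distrib[symmetric] by (intro sum.cong refl) (simp add: lookup_add algebra_simps)
qed

lemma odd_degree_single [simp]: "odd_degree \<pi> (sg x k) = (if \<pi> x = 1 then k else 0)"
  by (simp add: odd_degree_def)

lemma odd_degree_zero [simp]: "odd_degree \<pi> 0 = 0"
  by (simp add: odd_degree_def)

lemma swaps_swap_diag: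
  assumes "\<And>x. \<pi> x = 1 \<Longrightarrow> lk m x * lk n x = 0"
  shows "swaps \<pi> m n + swaps \<pi> n m = odd_degree \<pi> m * odd_degree \<pi> n"
proof -
  let ?S = "ks m \<union> ks n"
  have *: "finite ?S" "ks m \<subseteq> ?S" "ks n \<subseteq> ?S" by auto
  let ?f = "\<lambda>x y. if \<pi> x = 1 \<and> \<pi> y = 1 then lk m x * lk n y else 0"
  have 1: "swaps \<pi> m n = (\<Sum>x\<in>?S. \<Sum>y\<in>?S. if y < x then ?f x y else 0)"
    unfolding swaps_superset[OF *(1,2) *(1,3)] by (intro sum.cong refl) auto
  have "swaps \<pi> n m = (\<Sum>y\<in>?S. \<Sum>x\<in>?S. if x < y then ?f x y else 0)"
    unfolding swaps_superset[OF *(1,3) *(1,2)] by (intro sum.cong refl) auto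
  also have "\<dots> = (\<Sum>x\<in>?S. \<Sum>y\<in>?S. if x < y then ?f x y else 0)"
    by (rule sum.swap)
  finally have 2: "swaps \<pi> n m = (\<Sum>x\<in>?S. \<Sum>y\<in>?S. if x < y then ?f x y else 0)" .
  have "odd_degree \<pi> m * odd_degree \<pi> n = (\<Sum>x\<in>?S. \<Sum>y\<in>?S. ?f x y)"
    unfolding odd_degree_superset[OF *(1,2)] odd_degree_superset[OF *(1,3)] sum_product
    by (intro sum.cong refl) auto
  then show ?thesis
    unfolding 1 2 sum.distrib[symmetric] using assms
    by (auto intro!: sum.cong simp: not_less_iff_gr_or_eq)
qed

lemma monomials_add_D1:
  assumes "m + n \<in> monomials \<pi> X" shows "m \<in> monomials \<pi> X"
proof -
  have "lk m x \<le> lk (m + n) x" for x by (simp add: lookup_add)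
  moreover have "ks m \<subseteq> ks (m + n)" by (auto simp: in_keys_iff lookup_add)
  ultimately show ?thesis using assms unfolding monomials_def by (blast intro: order_trans)
qed

lemma monomials_add_D2: "m + n \<in> monomials \<pi> X \<Longrightarrow> n \<in> monomials \<pi> X"
  using monomials_add_D1[of n m] by (simp add: add.commute)

lemmas monomials_add_D = monomials_add_D1 monomials_add_D2

lemma monomials_UNIV: "m \<in> monomials \<pi> X \<Longrightarrow> m \<in> monomials \<pi> UNIV"
  unfolding monomials_def by auto

lemma monomials_add_I:
  "m \<in> monomials \<pi> X \<Longrightarrow> n \<in> monomials \<pi> X \<Longrightarrow> m + n \<in> monomials \<pi> UNIV \<Longrightarrow> m + n \<in> monomials \<pi> X"
  unfolding monomials_def using Poly_Mapping.keys_add[of m n] by auto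

lemma mon_coeff_comm:
  "mon_coeff \<pi> n m = (- 1) ^ (odd_degree \<pi> m * odd_degree \<pi> n) * mon_coeff \<pi> m n"
proof (cases "m + n \<in> monomials \<pi> UNIV")
  case True
  have "lk m x * lk n x = 0" if "\<pi> x = 1" for x
  proof -
    have "lk m x + lk n x \<le> 1" using True that by (auto simp: monomials_def lookup_add)
    hence "lk m x = 0 \<or> lk n x = 0" by linarith
    then show ?thesis by auto
  qed
  hence "odd_degree \<pi> m * odd_degree \<pi> n = swaps \<pi> m n + swaps \<pi> n m"
    by (simp add: swaps_swap_diag)
  then show ?thesis using True by (simp add: mon_coeff_def power_add add.commute mult_ac)
qed (simp add: mon_coeff_def add.commute)

lemma mon_coeff_assoc:
  "mon_coeff \<pi> m n * mon_coeff \<pi> (m + n) k = mon_coeff \<pi> n k * mon_coeff \<pi> m (n + k)"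
  using monomials_add_D[of "m+n" k \<pi> UNIV] monomials_add_D[of m "n+k" \<pi> UNIV]
  by (auto simp: mon_coeff_def swaps_add_left swaps_add_right power_add add.assoc)

lemma sprod_superset:
  assumes "finite S" "ks a \<subseteq> S" "finite T" "ks b \<subseteq> T"
  shows "sprod \<pi> a b = (\<Sum>m\<in>S. \<Sum>m'\<in>T. sg (m + m') (mon_coeff \<pi> m m' * lk a m * lk b m'))"
proof -
  have "sprod \<pi> a b = (\<Sum>m\<in>ks a. \<Sum>m'\<in>T. sg (m + m') (mon_coeff \<pi> m m' * lk a m * lk b m'))"
    unfolding sprod_def
    by (intro sum.cong refl sum.mono_neutral_left assms) (auto simp: in_keys_iff)
  also have "\<dots> = (\<Sum>m\<in>S. \<Sum>m'\<in>T. sg (m + m') (mon_coeff \<pi> m m' * lk a m * lk b m'))"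
    by (intro sum.mono_neutral_left assms) (auto simp: in_keys_iff intro!: sum.neutral)
  finally show ?thesis .
qed

lemma sprod_add_left: "sprod \<pi> (a + a') b = sprod \<pi> a b + sprod \<pi> a' b"
proof -
  let ?S = "ks a \<union> ks a'" let ?T = "ks b"
  have *: "finite ?S" "ks (a+a') \<subseteq> ?S" "finite ?T" "ks a \<subseteq> ?S" "ks a' \<subseteq> ?S" "ks b \<subseteq> ?T"
    using Poly_Mapping.keys_add[of a a'] by auto
  show ?thesis
    unfolding sprod_superset[OF *(1,2,3,6)] sprod_superset[OF *(1,4,3,6)] sprod_superset[OF *(1,5,3,6)]
    unfolding sum.distrib[symmetric] by (intro sum.cong refl) (simp only: lookup_add ring_distribs single_add)
qed

lemma sprod_add_right: "sprod \<pi> b (a + a') = sprod \<pi> b a + sprod \<pi> b a'"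
proof -
  let ?S = "ks a \<union> ks a'" let ?T = "ks b"
  have *: "finite ?S" "ks (a+a') \<subseteq> ?S" "finite ?T" "ks a \<subseteq> ?S" "ks a' \<subseteq> ?S" "ks b \<subseteq> ?T"
    using Poly_Mapping.keys_add[of a a'] by auto
  show ?thesis
    unfolding sprod_superset[OF *(3,6,1,2)] sprod_superset[OF *(3,6,1,4)] sprod_superset[OF *(3,6,1,5)]
    unfolding sum.distrib[symmetric] by (intro sum.cong refl) (simp only: lookup_add ring_distribs single_add)
qed

lemma sprod_zero [simp]: "sprod \<pi> 0 a = 0" "sprod \<pi> a 0 = 0"
  by (simp_all add: sprod_def)

lemma sprod_single:
  "sprod \<pi> (sg m c) (sg n d) = sg (m + n) (mon_coeff \<pi> m n * c * d)"
  by (subst sprod_superset[where S = "{m}" and T = "{n}"]) auto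

lemma scale_add: "scale c (a + b) = scale c a + scale c b"
  by (rule poly_mapping_eqI) (simp add: lookup_add algebra_simps)

lemma scale_scale: "scale c (scale d a) = scale (c * d) a"
  by (rule poly_mapping_eqI) simp

lemma scale_single [simp]: "scale c (sg m d) = sg m (c * d)"
  by (rule poly_mapping_eqI) (simp add: lookup_single when_def)

lemma scale_zero [simp]: "scale c 0 = 0" "scale 0 a = 0" "scale 1 a = a"
  by (auto intro!: poly_mapping_eqI)

lemma salg_induct [consumes 1, case_names zero single add]:
  assumes "ks a \<subseteq> M"
    and "P 0"
    and "\<And>m c. m \<in> M \<Longrightarrow> P (sg m c)"
    and "\<And>a b. ks a \<subseteq> M \<Longrightarrow> ks b \<subseteq> M \<Longrightarrow> P a \<Longrightarrow> P b \<Longrightarrow> P (a + b)"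
  shows "P (a::'x salg)"
proof -
  have "a = (\<Sum>m\<in>ks a. sg m (lk a m))"
    by (rule poly_mapping_eqI) (auto simp: lookup_sum lookup_single when_def in_keys_iff sum.delta')
  moreover have "P (\<Sum>m\<in>S. sg m (lk a m)) \<and> ks (\<Sum>m\<in>S. sg m (lk a m)) \<subseteq> M"
    if "finite S" "S \<subseteq> M" for S using that
  proof (induction S rule: finite_induct)
    case (insert x F)
    have "ks (sg x (lk a x)) \<subseteq> M" using insert by auto
    moreover have "ks (sg x (lk a x) + (\<Sum>m\<in>F. sg m (lk a m))) \<subseteq> M"
      using insert Poly_Mapping.keys_add[of "sg x (lk a x)" "\<Sum>m\<in>F. sg m (lk a m)"] by (auto split: if_splits)
    ultimately show ?case using insert assms(3)[of x] assms(4) by auto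
  qed (use assms in auto)
  ultimately show ?thesis using assms(1) by (metis finite_keys)
qed

lemma salg_induct_UNIV [case_names zero single add]:
  assumes "P 0" "\<And>m c. P (sg m c)" "\<And>a b. P a \<Longrightarrow> P b \<Longrightarrow> P (a + b)"
  shows "P (a::'x salg)"
  by (rule salg_induct[of a UNIV]) (use assms in auto)

lemma sprod_scale_left: "sprod \<pi> (scale c a) b = scale c (sprod \<pi> a b)"
proof (induction a rule: salg_induct_UNIV)
  case (single m d)
  show ?case
    by (induction b rule: salg_induct_UNIV) (auto simp: sprod_add_right scale_add sprod_single mult_ac)
qed (auto simp: sprod_add_left scale_add)

lemma sprod_scale_right: "sprod \<pi> a (scale c b) = scale c (sprod \<pi> a b)"
proof (induction a rule: salg_induct_UNIV)
  case (single m d)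
  show ?case
    by (induction b rule: salg_induct_UNIV) (auto simp: sprod_add_right scale_add sprod_single mult_ac)
qed (auto simp: sprod_add_left scale_add)

theorem sprod_assoc: "sprod \<pi> (sprod \<pi> a b) c = sprod \<pi> a (sprod \<pi> b c)"
proof -
  have 1: "sprod \<pi> (sprod \<pi> (sg m u) (sg n v)) (sg k w) = sprod \<pi> (sg m u) (sprod \<pi> (sg n v) (sg k w))" for m n k u v w
    using mon_coeff_assoc[of \<pi> m n k] by (simp add: sprod_single add.assoc mult_ac)
  have 2: "sprod \<pi> (sprod \<pi> (sg m u) (sg n v)) c = sprod \<pi> (sg m u) (sprod \<pi> (sg n v) c)" for m n u v
    by (induction c rule: salg_induct_UNIV) (auto simp: 1 sprod_add_right)
  have 3: "sprod \<pi> (sprod \<pi> (sg m u) b) c = sprod \<pi> (sg m u) (sprod \<pi> b c)" for m u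
    by (induction b rule: salg_induct_UNIV) (auto simp: 2 sprod_add_right sprod_add_left)
  show ?thesis
    by (induction a rule: salg_induct_UNIV) (auto simp: 3 sprod_add_left)
qed

lemma zero_mem_salg [simp]: "0 \<in> salg \<pi> X"
  by (simp add: salg_def)

lemma one_mem_salg [simp]: "1 \<in> salg \<pi> X"
  by (simp add: salg_def monomials_def)

lemma add_mem_salg: "a \<in> salg \<pi> X \<Longrightarrow> b \<in> salg \<pi> X \<Longrightarrow> a + b \<in> salg \<pi> X"
  using Poly_Mapping.keys_add[of a b] by (auto simp: salg_def)

lemma single_mem_salg: "m \<in> monomials \<pi> X \<Longrightarrow> sg m c \<in> salg \<pi> X"
  by (simp add: salg_def)

lemma scale_mem_salg: "a \<in> salg \<pi> X \<Longrightarrow> scale c a \<in> salg \<pi> X"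
  by (auto simp: salg_def in_keys_iff)

lemma sum_mem_salg: "(\<And>i. i \<in> I \<Longrightarrow> f i \<in> salg \<pi> X) \<Longrightarrow> sum f I \<in> salg \<pi> X"
  by (induction I rule: infinite_finite_induct) (auto intro: add_mem_salg)

theorem sprod_mem_salg:
  assumes "a \<in> salg \<pi> X" "b \<in> salg \<pi> X"
  shows "sprod \<pi> a b \<in> salg \<pi> X"
proof -
  have 1: "sg (m + m') (mon_coeff \<pi> m m' * u * v) \<in> salg \<pi> X"
    if "m \<in> monomials \<pi> X" "m' \<in> monomials \<pi> X" for m m' u v
    using that monomials_add_I[of m \<pi> X m'] by (cases "m + m' \<in> monomials \<pi> UNIV")
      (auto simp: mon_coeff_def intro: single_mem_salg)
  show ?thesis
    unfolding sprod_def by (intro sum_mem_salg 1) (use assms in \<open>auto simp: salg_def\<close>)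
qed

theorem sprod_one:
  assumes "a \<in> salg \<pi> X"
  shows "sprod \<pi> 1 a = a" "sprod \<pi> a 1 = a"
proof -
  have *: "ks a \<subseteq> monomials \<pi> UNIV" using assms monomials_UNIV by (auto simp: salg_def)
  have 1: "(1::'x salg) = sg 0 1" by (simp only: single_one)
  show "sprod \<pi> 1 a = a"
    using * unfolding 1 by (induction a rule: salg_induct) (auto simp: sprod_single sprod_add_right mon_coeff_def simp del: single_one)
  show "sprod \<pi> a 1 = a"
    using * unfolding 1 by (induction a rule: salg_induct) (auto simp: sprod_single sprod_add_left mon_coeff_def simp del: single_one)
qed

theorem sprod_supercommute:
  assumes "homogeneous \<pi> r a" "homogeneous \<pi> s b"
  shows "sprod \<pi> b a = scale (ksign (r * s)) (sprod \<pi> a b)"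
proof -
  have a: "ks a \<subseteq> {m. of_nat (odd_degree \<pi> m) = r}" and b: "ks b \<subseteq> {m. of_nat (odd_degree \<pi> m) = s}"
    using assms by (auto simp: homogeneous_def)
  have 1: "sprod \<pi> b (sg m u) = scale (ksign (r * s)) (sprod \<pi> (sg m u) b)"
    if m: "of_nat (odd_degree \<pi> m) = r" for m u
    using b
  proof (induction b rule: salg_induct)
    case (single n v)
    hence n: "of_nat (odd_degree \<pi> n) = s" by blast
    have "ksign (r * s) = (- 1) ^ (odd_degree \<pi> m * odd_degree \<pi> n)"
      unfolding m[symmetric] n[symmetric] by (rule ksign_of_nat_mult)
    then show ?case
      unfolding sprod_single scale_single mon_coeff_comm[of \<pi> n m] add.commute[of n m]
      by (simp only: mult_ac)
  qed (simp_all add: sprod_add_left sprod_add_right scale_add)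
  show ?thesis
    using a
  proof (induction a rule: salg_induct)
    case (single m u)
    then show ?case using 1 by blast
  qed (simp_all add: sprod_add_left sprod_add_right scale_add)
qed


subsection \<open>Existence and uniqueness of the dual derivations\<close>

definition partial_mon :: "('x::linorder \<Rightarrow> bit) \<Rightarrow> 'x \<Rightarrow> ('x \<Rightarrow>\<^sub>0 nat) \<Rightarrow> complex \<Rightarrow> 'x salg" where
  "partial_mon \<pi> x m c =
    sg (m - sg x 1) ((- 1) ^ swaps \<pi> (sg x 1) m * of_nat (lk m x) * c)"

definition partial_formula :: "('x::linorder \<Rightarrow> bit) \<Rightarrow> 'x \<Rightarrow> 'x salg \<Rightarrow> 'x salg" where
  "partial_formula \<pi> x a = (\<Sum>m\<in>ks a. partial_mon \<pi> x m (lk a m))"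

lemma partial_mon_zero [simp]: "partial_mon \<pi> x m 0 = 0"
  by (simp add: partial_mon_def)

lemma partial_formula_superset:
  assumes "finite S" "ks a \<subseteq> S"
  shows "partial_formula \<pi> x a = (\<Sum>m\<in>S. partial_mon \<pi> x m (lk a m))"
  unfolding partial_formula_def
  by (intro sum.mono_neutral_left assms) (auto simp: in_keys_iff)

lemma partial_formula_add: "partial_formula \<pi> x (a + b) = partial_formula \<pi> x a + partial_formula \<pi> x b"
proof -
  let ?S = "ks a \<union> ks b"
  have *: "finite ?S" "ks (a+b) \<subseteq> ?S" "ks a \<subseteq> ?S" "ks b \<subseteq> ?S"
    using Poly_Mapping.keys_add[of a b] by auto
  show ?thesis
    unfolding partial_formula_superset[OF *(1,2)] partial_formula_superset[OF *(1,3)] partial_formula_superset[OF *(1,4)]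
    unfolding sum.distrib[symmetric] by (intro sum.cong refl) (simp only: partial_mon_def lookup_add ring_distribs single_add)
qed

lemma partial_formula_zero [simp]: "partial_formula \<pi> x 0 = 0"
  by (simp add: partial_formula_def)

lemma partial_formula_single: "partial_formula \<pi> x (sg m c) = partial_mon \<pi> x m c"
  by (subst partial_formula_superset[where S = "{m}"]) auto

lemma partial_formula_scale: "partial_formula \<pi> x (scale c a) = scale c (partial_formula \<pi> x a)"
  by (induction a rule: salg_induct_UNIV)
    (auto simp: partial_formula_add partial_formula_single scale_add partial_mon_def mult_ac)

lemma split_off: "lk m x > 0 \<Longrightarrow> \<exists>u. m = sg x (Suc 0) + u"
  by (rule exI[of _ "m - sg x (Suc 0)"], rule poly_mapping_eqI)
    (auto simp: lookup_add lookup_minus lookup_single when_def)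

lemma swaps_self_single [simp]: "swaps \<pi> (sg x j) (sg x k) = 0"
  by (simp add: swaps_def)

lemma swaps_even: "\<pi> x = 0 \<Longrightarrow> swaps \<pi> (sg x k) m = 0" "\<pi> x = 0 \<Longrightarrow> swaps \<pi> m (sg x k) = 0"
  by (auto simp: swaps_def intro!: sum.neutral)

lemma swaps_odd_swap:
  assumes "\<pi> x = 1" "lk m x = 0"
  shows "(- 1) ^ swaps \<pi> m (sg x (Suc 0)) = (- 1) ^ swaps \<pi> (sg x (Suc 0)) m * (- 1 :: complex) ^ odd_degree \<pi> m"
proof -
  have "odd_degree \<pi> m = swaps \<pi> (sg x (Suc 0)) m + swaps \<pi> m (sg x (Suc 0))"
    using assms by (subst swaps_swap_diag) (auto simp: lookup_single when_def)
  then show ?thesis by (simp add: power_add)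
qed

lemma monomials_add_single_even:
  assumes "\<pi> x = 0"
  shows "sg x (Suc 0) + m \<in> monomials \<pi> UNIV \<longleftrightarrow> m \<in> monomials \<pi> UNIV"
proof -
  have "lk (sg x (Suc 0) + m) y = lk m y" if "\<pi> y = 1" for y
  proof -
    have "x \<noteq> y" using assms that by (metis zero_neq_one)
    then show ?thesis by (simp add: lookup_add lookup_single)
  qed
  then have "(\<forall>y. \<pi> y = 1 \<longrightarrow> lk (sg x (Suc 0) + m) y \<le> 1) \<longleftrightarrow> (\<forall>y. \<pi> y = 1 \<longrightarrow> lk m y \<le> 1)"
    by (simp only: cong: imp_cong)
  then show ?thesis unfolding monomials_def by (simp only: mem_Collect_eq subset_UNIV)
qed

lemma monomials_add_single_odd:
  assumes "\<pi> x = 1"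
  shows "sg x (Suc 0) + m \<in> monomials \<pi> UNIV \<longleftrightarrow> m \<in> monomials \<pi> UNIV \<and> lk m x = 0"
proof
  assume *: "sg x (Suc 0) + m \<in> monomials \<pi> UNIV"
  hence "lk (sg x (Suc 0) + m) x \<le> 1" using assms unfolding monomials_def by blast
  hence "lk m x = 0" by (simp add: lookup_add)
  then show "m \<in> monomials \<pi> UNIV \<and> lk m x = 0" using monomials_add_D2[OF *] by blast
next
  assume *: "m \<in> monomials \<pi> UNIV \<and> lk m x = 0"
  have "lk (sg x (Suc 0) + m) y \<le> 1" if "\<pi> y = 1" for y
  proof (cases "y = x")
    case True
    then show ?thesis using * by (simp add: lookup_add)
  next
    case False
    have "lk m y \<le> 1" using * that unfolding monomials_def by blast
    then show ?thesis using False by (simp add: lookup_add lookup_single)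
  qed
  then show "sg x (Suc 0) + m \<in> monomials \<pi> UNIV" unfolding monomials_def by blast
qed

lemma partial_mon_split:
  "partial_mon \<pi> x (sg x (Suc 0) + u) c =
    sg u ((- 1) ^ swaps \<pi> (sg x (Suc 0)) u * of_nat (Suc (lk u x)) * c)"
  by (simp add: partial_mon_def swaps_add_right lookup_add)

lemma partial_mon_absent: "lk m x = 0 \<Longrightarrow> partial_mon \<pi> x m c = 0"
  by (simp add: partial_mon_def)

lemma ksign_parity: "ksign (\<pi> x * of_nat k) = (if \<pi> x = 1 then (- 1) ^ k else 1)"
  by (cases "\<pi> x") (simp_all only: mult_1 ksign_of_nat mult_zero_left ksign_0 if_True if_False zero_neq_one refl)

lemma partial_formula_Leibniz_single:
  assumes m: "m \<in> monomials \<pi> UNIV" and n: "n \<in> monomials \<pi> UNIV"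
  shows "partial_formula \<pi> x (sprod \<pi> (sg m c) (sg n d)) =
    sprod \<pi> (partial_mon \<pi> x m c) (sg n d) +
    scale (ksign (\<pi> x * of_nat (odd_degree \<pi> m))) (sprod \<pi> (sg m c) (partial_mon \<pi> x n d))"
proof -
  let ?e = "sg x (Suc 0)"
  consider "lk m x = 0" "lk n x = 0" | u where "m = ?e + u" "lk n x = 0"
    | w where "lk m x = 0" "n = ?e + w" | u w where "m = ?e + u" "n = ?e + w"
    using split_off by (metis neq0_conv)
  then show ?thesis
  proof cases
    case 1
    then show ?thesis by (simp add: sprod_single partial_formula_single partial_mon_absent lookup_add)
  next
    case 2
    have *: "?e + (u + n) \<in> monomials \<pi> UNIV \<longleftrightarrow> u + n \<in> monomials \<pi> UNIV"
    proof (cases "\<pi> x = 1")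
      case True
      then show ?thesis using 2 m by (simp add: monomials_add_single_odd lookup_add)
    qed (simp add: monomials_add_single_even)
    show ?thesis
      unfolding 2(1) using * 2(2)
      by (simp add: sprod_single partial_formula_single partial_mon_absent partial_mon_split add.assoc
          mon_coeff_def swaps_add_left swaps_add_right power_add lookup_add mult_ac)
  next
    case 3
    have comm: "m + (?e + w) = ?e + (m + w)" by (simp add: add_ac)
    have *: "?e + (m + w) \<in> monomials \<pi> UNIV \<longleftrightarrow> m + w \<in> monomials \<pi> UNIV"
    proof (cases "\<pi> x = 1")
      case True
      then show ?thesis using 3 n by (simp add: monomials_add_single_odd lookup_add)
    qed (simp add: monomials_add_single_even)
    have s: "(- 1) ^ swaps \<pi> m ?e = (- 1) ^ swaps \<pi> ?e m * ksign (\<pi> x * of_nat (odd_degree \<pi> m))"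
      unfolding ksign_parity using swaps_odd_swap[of \<pi> x m] 3 by (cases "\<pi> x = 1") (simp_all add: swaps_even)
    show ?thesis
      unfolding 3(2) using * 3(1)
      by (simp add: sprod_single partial_formula_single partial_mon_absent partial_mon_split comm
          mon_coeff_def swaps_add_left swaps_add_right power_add lookup_add s mult_ac)
  next
    case 4
    have a1: "?e + u + (?e + w) = ?e + (?e + (u + w))" "u + (?e + w) = ?e + (u + w)" "?e + u + w = ?e + (u + w)"
      by (simp_all add: add_ac)
    show ?thesis
    proof (cases "\<pi> x = 1")
      case True
      have u: "lk u x = 0" and w: "lk w x = 0"
        using m n 4 True by (auto simp: monomials_add_single_odd)
      show ?thesis
        unfolding 4 sprod_single partial_formula_single partial_mon_split scale_single a1 mon_coeff_def ksign_parity
        using True u w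
        by (simp add: monomials_add_single_odd lookup_add swaps_add_left swaps_add_right power_add
            swaps_odd_swap odd_degree_add single_add[symmetric] mult_ac)
    next
      case False
      hence 0: "\<pi> x = 0" by simp
      let ?k = "mon_coeff \<pi> u w"
      have k: "mon_coeff \<pi> (?e + u) (?e + w) = ?k" "mon_coeff \<pi> u (?e + w) = ?k" "mon_coeff \<pi> (?e + u) w = ?k"
        by (simp_all only: mon_coeff_def a1 monomials_add_single_even[of \<pi> x, OF 0] swaps_add_left swaps_add_right
            swaps_even[of \<pi> x, OF 0] add_0)
      have z: "of_nat (Suc (lk (?e + (u + w)) x)) = (of_nat (Suc (lk u x)) + of_nat (Suc (lk w x)) :: complex)"
        by (simp add: lookup_add)
      have "?k * c * d * (of_nat (Suc (lk u x)) + of_nat (Suc (lk w x))) =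
          ?k * (of_nat (Suc (lk u x)) * c) * d + ?k * c * (of_nat (Suc (lk w x)) * d)"
        by (simp only: ring_distribs mult_ac)
      then show ?thesis
        unfolding 4 sprod_single partial_formula_single
        unfolding a1(1) partial_mon_split sprod_single scale_single a1(2,3) k z ksign_parity single_add[symmetric]
        by (simp only: swaps_even[of \<pi> x, OF 0] False if_False power_0 mult_1 mult_1_left) (simp only: mult_ac)
    qed
  qed
qed

lemma partial_mon_mem:
  assumes "m \<in> monomials \<pi> X" shows "partial_mon \<pi> x m c \<in> salg \<pi> X"
proof (cases "lk m x = 0")
  case False
  then obtain u where u: "m = sg x (Suc 0) + u" using split_off[of m x] by auto
  have "u \<in> monomials \<pi> X" using assms unfolding u by (rule monomials_add_D(2))
  then show ?thesis unfolding u partial_mon_split by (rule single_mem_salg)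
qed (simp add: partial_mon_absent)

lemma partial_mon_homogeneous:
  "homogeneous \<pi> (of_nat (odd_degree \<pi> m) + \<pi> x) (partial_mon \<pi> x m c)"
proof (cases "lk m x = 0")
  case False
  then obtain u where u: "m = sg x (Suc 0) + u" using split_off[of m x] by auto
  have "of_nat (odd_degree \<pi> m) + \<pi> x = of_nat (odd_degree \<pi> u)"
    unfolding u odd_degree_add by (cases "\<pi> x") (simp_all add: add.commute)
  then show ?thesis unfolding u partial_mon_split homogeneous_def by (simp del: of_nat_add)
qed (simp add: partial_mon_absent homogeneous_def)

lemma homogeneous_add: "homogeneous \<pi> r a \<Longrightarrow> homogeneous \<pi> r b \<Longrightarrow> homogeneous \<pi> r (a + b)"
  using Poly_Mapping.keys_add[of a b] by (auto simp: homogeneous_def)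

theorem dual_derivation_partial_formula: "dual_derivation \<pi> X x (partial_formula \<pi> x)"
  unfolding dual_derivation_def graded_derivation_def
proof (intro conjI ballI allI impI)
  fix a assume "a \<in> salg \<pi> X"
  hence "ks a \<subseteq> monomials \<pi> X" by (simp add: salg_def)
  then show "partial_formula \<pi> x a \<in> salg \<pi> X"
    by (induction a rule: salg_induct) (auto simp: partial_formula_add partial_formula_single intro: add_mem_salg partial_mon_mem)
next
  fix r a assume "homogeneous \<pi> r a"
  hence "ks a \<subseteq> {m. of_nat (odd_degree \<pi> m) = r}" by (auto simp: homogeneous_def)
  then show "homogeneous \<pi> (r + \<pi> x) (partial_formula \<pi> x a)"
  proof (induction a rule: salg_induct)
    case zero
    then show ?case by (simp add: homogeneous_def)
  next
    case (single m c)
    then show ?case using partial_mon_homogeneous[of \<pi> m x c] by (simp only: partial_formula_single mem_Collect_eq)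
  next
    case (add a b)
    then show ?case by (simp only: partial_formula_add homogeneous_add)
  qed
next
  fix r a b assume "a \<in> salg \<pi> X" "b \<in> salg \<pi> X" "homogeneous \<pi> r a"
  hence a: "ks a \<subseteq> {m \<in> monomials \<pi> UNIV. of_nat (odd_degree \<pi> m) = r}" and b: "ks b \<subseteq> monomials \<pi> UNIV"
    unfolding homogeneous_def salg_def using monomials_UNIV[of _ \<pi> X] by blast+
  have 1: "partial_formula \<pi> x (sprod \<pi> (sg m c) b) = sprod \<pi> (partial_mon \<pi> x m c) b +
      scale (ksign (\<pi> x * r)) (sprod \<pi> (sg m c) (partial_formula \<pi> x b))"
    if "m \<in> monomials \<pi> UNIV" "of_nat (odd_degree \<pi> m) = r" for m c
    using b
  proof (induction b rule: salg_induct)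
    case (single n d)
    show ?case
      using partial_formula_Leibniz_single[OF that(1) single, of x c d]
      unfolding that(2) partial_formula_single .
  qed (simp_all add: partial_formula_add sprod_add_right scale_add)
  show "partial_formula \<pi> x (sprod \<pi> a b) =
      sprod \<pi> (partial_formula \<pi> x a) b + scale (ksign (\<pi> x * r)) (sprod \<pi> a (partial_formula \<pi> x b))"
    using a
  proof (induction a rule: salg_induct)
    case (single m c)
    then show ?case unfolding partial_formula_single using 1 by blast
  qed (simp_all add: partial_formula_add sprod_add_left scale_add)
next
  fix y show "partial_formula \<pi> x (gen y) = (if y = x then 1 else 0)"
    by (auto simp: gen_def partial_formula_single partial_mon_def lookup_single when_def)
qed (auto simp: partial_formula_add partial_formula_scale)

theorem dual_derivation_partial: "dual_derivation \<pi> X x (partial \<pi> X x)"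
  unfolding partial_def by (rule someI[of "dual_derivation \<pi> X x", OF dual_derivation_partial_formula])

lemma graded_derivation_single_unique:
  assumes D: "graded_derivation \<pi> X d D" and E: "graded_derivation \<pi> X d E"
    and gens: "\<And>y. y \<in> X \<Longrightarrow> D (gen y) = E (gen y)"
    and "m \<in> monomials \<pi> X"
  shows "D (sg m 1) = E (sg m 1)"
  using \<open>m \<in> monomials \<pi> X\<close>
proof (induction "\<Sum>x\<in>ks m. lk m x" arbitrary: m rule: less_induct)
  case less
  have one: "F 1 = 0" if F: "graded_derivation \<pi> X d F" for F :: "'a salg \<Rightarrow> 'a salg"
  proof -
    have "homogeneous \<pi> 0 1" by (simp add: homogeneous_def)
    hence "F (sprod \<pi> 1 1) = sprod \<pi> (F 1) 1 + scale (ksign (d * 0)) (sprod \<pi> 1 (F 1))"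
      using F unfolding graded_derivation_def by (metis one_mem_salg)
    moreover have "F 1 \<in> salg \<pi> X" using F by (simp add: graded_derivation_def)
    ultimately show ?thesis by (simp add: sprod_one[of _ \<pi> X])
  qed
  show ?case
  proof (cases "m = 0")
    case True
    then show ?thesis using one[OF D] one[OF E] by simp
  next
    case False
    then obtain y where y: "y \<in> ks m" by fastforce
    then obtain u where u: "m = sg y (Suc 0) + u" using split_off by (metis in_keys_iff neq0_conv)
    have umon: "u \<in> monomials \<pi> X" and ymon: "sg y (Suc 0) \<in> monomials \<pi> X"
      using monomials_add_D[of "sg y (Suc 0)" u \<pi> X] less.prems unfolding u by simp_all
    have yX: "y \<in> X" using y less.prems by (auto simp: monomials_def)
    have mem: "gen y \<in> salg \<pi> X" "sg u 1 \<in> salg \<pi> X"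
      using ymon umon by (auto simp: gen_def intro: single_mem_salg)
    have hom: "homogeneous \<pi> (\<pi> y) (gen y)" by (auto simp: homogeneous_def gen_def)
    have "(\<Sum>x\<in>ks u. lk u x) = (\<Sum>x\<in>ks m. lk u x)"
      by (intro sum.mono_neutral_left) (auto simp: u in_keys_iff lookup_add)
    also have "\<dots> < (\<Sum>x\<in>ks m. lk m x)"
      using y by (intro sum_strict_mono_ex1) (auto simp: u lookup_add intro!: bexI[of _ y])
    finally have IH: "D (sg u 1) = E (sg u 1)" using less.hyps umon by blast
    let ?s = "(- 1) ^ swaps \<pi> (sg y (Suc 0)) u :: complex"
    have "sprod \<pi> (gen y) (sg u 1) = sg m ?s"
      using monomials_UNIV[OF less.prems] by (simp add: gen_def sprod_single mon_coeff_def u)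
    hence m: "sg m 1 = scale ?s (sprod \<pi> (gen y) (sg u 1))" by simp
    have "F (sg m 1) = scale ?s (sprod \<pi> (F (gen y)) (sg u 1) + scale (ksign (d * \<pi> y)) (sprod \<pi> (gen y) (F (sg u 1))))"
      if F: "graded_derivation \<pi> X d F" for F
    proof -
      have "F (scale ?s (sprod \<pi> (gen y) (sg u 1))) = scale ?s (F (sprod \<pi> (gen y) (sg u 1)))"
        using F sprod_mem_salg[OF mem] unfolding graded_derivation_def by blast
      moreover have "F (sprod \<pi> (gen y) (sg u 1)) =
          sprod \<pi> (F (gen y)) (sg u 1) + scale (ksign (d * \<pi> y)) (sprod \<pi> (gen y) (F (sg u 1)))"
        using F mem hom unfolding graded_derivation_def by blast
      ultimately show ?thesis unfolding m by simp
    qed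
    from this[OF D] this[OF E] show ?thesis unfolding IH gens[OF yX] by simp
  qed
qed

theorem dual_derivation_unique:
  assumes "dual_derivation \<pi> X x D" "dual_derivation \<pi> X x E" "a \<in> salg \<pi> X"
  shows "D a = E a"
proof -
  have D: "graded_derivation \<pi> X (\<pi> x) D" and E: "graded_derivation \<pi> X (\<pi> x) E"
    and g: "\<And>y. y \<in> X \<Longrightarrow> D (gen y) = E (gen y)"
    using assms unfolding dual_derivation_def by auto
  note s = graded_derivation_single_unique[OF D E g]
  have sc: "F (scale c a) = scale c (F a)" and ad: "b \<in> salg \<pi> X \<Longrightarrow> F (a + b) = F a + F b"
    if "graded_derivation \<pi> X (\<pi> x) F" "a \<in> salg \<pi> X" for F a b c
    using that by (auto simp: graded_derivation_def)
  have 1: "D (sg m c) = E (sg m c)" if "m \<in> monomials \<pi> X" for m c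
    using s[OF _ that] sc[OF D, of "sg m 1" c] sc[OF E, of "sg m 1" c] single_mem_salg[OF that] by simp
  have "ks a \<subseteq> monomials \<pi> X" using assms by (simp add: salg_def)
  then show ?thesis
  proof (induction a rule: salg_induct)
    case zero
    then show ?case using sc[OF D, of 0 0] sc[OF E, of 0 0] by simp
  next
    case (add a b)
    then show ?case using ad[OF D] ad[OF E] by (simp add: salg_def)
  qed (rule 1)
qed

corollary partial_eq_formula: "a \<in> salg \<pi> X \<Longrightarrow> partial \<pi> X x a = partial_formula \<pi> x a"
  using dual_derivation_unique dual_derivation_partial dual_derivation_partial_formula by blast


section \<open>Super vector spaces in duality\<close>

text \<open>The family \<open>G\<close> consists of the even part \<open>G 0\<close> and the odd part \<open>G 1\<close>.\<close>

definition super_vector_space ::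
  "(complex \<Rightarrow> 'v \<Rightarrow> 'v) \<Rightarrow> (bit \<Rightarrow> 'v::ab_group_add set) \<Rightarrow> bool" where
  "super_vector_space s G \<longleftrightarrow> vector_space s \<and>
    module.subspace s (G 0) \<and> module.subspace s (G 1) \<and>
    G 0 \<inter> G 1 = {0} \<and> (\<forall>v. \<exists>a\<in>G 0. \<exists>b\<in>G 1. v = a + b)"

definition pure_of_parity :: "bit \<Rightarrow> (bit \<Rightarrow> 'v set) \<Rightarrow> bool" where
  "pure_of_parity p G \<longleftrightarrow> G p = UNIV"

definition basis_of ::
  "(complex \<Rightarrow> 'v \<Rightarrow> 'v) \<Rightarrow> nat \<Rightarrow> (nat \<Rightarrow> 'v::ab_group_add) \<Rightarrow> bool" where
  "basis_of s n e \<longleftrightarrow> inj_on e {..<n} \<and> \<not> module.dependent s (e ` {..<n}) \<and>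
    module.span s (e ` {..<n}) = UNIV"

definition perfect_pairing ::
  "(complex \<Rightarrow> 'v \<Rightarrow> 'v) \<Rightarrow> (complex \<Rightarrow> 'w \<Rightarrow> 'w) \<Rightarrow>
   ('v::ab_group_add \<Rightarrow> 'w::ab_group_add \<Rightarrow> complex) \<Rightarrow> bool" where
  "perfect_pairing s0 s1 B \<longleftrightarrow>
    (\<forall>w. Vector_Spaces.linear s0 (*) (\<lambda>v. B v w)) \<and>
    (\<forall>v. Vector_Spaces.linear s1 (*) (\<lambda>w. B v w)) \<and>
    bij_betw (\<lambda>v w. B v w) UNIV {f. Vector_Spaces.linear s1 (*) f} \<and>
    bij_betw (\<lambda>w v. B v w) UNIV {f. Vector_Spaces.linear s0 (*) f}"

text \<open>
  Rows are indexed by the basis of \<open>V\<^sub>1\<close> and columns by that of \<open>V\<^sub>0\<close>.  Hence in an entry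
  \<open>I\<^sup>i\<^sup>j\<close> of the inverse the index \<open>i\<close> belongs to \<open>V\<^sub>0\<close> and \<open>j\<close> to \<open>V\<^sub>1\<close>, and the operator below does
  not depend on the bases.
\<close>

definition pairing_matrix ::
  "nat \<Rightarrow> ('v \<Rightarrow> 'w \<Rightarrow> complex) \<Rightarrow> (nat \<Rightarrow> 'v) \<Rightarrow> (nat \<Rightarrow> 'w) \<Rightarrow> complex mat" where
  "pairing_matrix n B e0 e1 = mat n n (\<lambda>(j, i). B (e0 i) (e1 j))"


section \<open>The operator \<open>\<Delta>\<close>\<close>

text \<open>
  \<open>V0 i\<close> and \<open>V1 j\<close> are the generators \<open>v\<^sup>0\<^sub>i\<close> and \<open>v\<^sup>1\<^sub>j\<close>, i.e. the elements of the bases of the dual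
  spaces that are dual to the chosen bases.  All \<open>V0 i\<close> precede all \<open>V1 j\<close>.
\<close>

datatype generator = V0 nat | V1 nat

instantiation generator :: linorder
begin

fun less_eq_generator :: "generator \<Rightarrow> generator \<Rightarrow> bool" where
  "less_eq_generator (V0 i) (V0 j) = (i \<le> j)"
| "less_eq_generator (V0 i) (V1 j) = True"
| "less_eq_generator (V1 i) (V0 j) = False"
| "less_eq_generator (V1 i) (V1 j) = (i \<le> j)"

definition less_generator :: "generator \<Rightarrow> generator \<Rightarrow> bool" where
  "less_generator x y \<longleftrightarrow> x \<le> y \<and> \<not> y \<le> x"

instance
proof
  fix x y z :: generator
  show "x < y \<longleftrightarrow> x \<le> y \<and> \<not> y \<le> x" by (rule less_generator_def)
  show "x \<le> x" by (cases x) auto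
  show "x \<le> y \<Longrightarrow> y \<le> z \<Longrightarrow> x \<le> z" by (cases x; cases y; cases z) auto
  show "x \<le> y \<Longrightarrow> y \<le> x \<Longrightarrow> x = y" by (cases x; cases y) auto
  show "x \<le> y \<or> y \<le> x" by (cases x; cases y) auto
qed

end

fun gen_parity :: "bit \<Rightarrow> bit \<Rightarrow> generator \<Rightarrow> bit" where
  "gen_parity p q (V0 i) = p"
| "gen_parity p q (V1 j) = q"

definition gens :: "nat \<Rightarrow> generator set" where
  "gens n = V0 ` {..<n} \<union> V1 ` {..<n}"

text \<open>The algebra \<open>A\<^sub>p(V\<^sub>0) \<otimes> A\<^sub>q(V\<^sub>1)\<close>.\<close>

definition alg :: "bit \<Rightarrow> bit \<Rightarrow> nat \<Rightarrow> generator salg set" where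
  "alg p q n = salg (gen_parity p q) (gens n)"

definition Delta ::
  "bit \<Rightarrow> bit \<Rightarrow> nat \<Rightarrow> complex mat \<Rightarrow> generator salg \<Rightarrow> generator salg" where
  "Delta p q n Iinv a =
    (\<Sum>i<n. \<Sum>j<n. scale (Iinv $$ (i, j))
       (partial (gen_parity p q) (gens n) (V0 i) (partial (gen_parity p q) (gens n) (V1 j) a)))"

end

theory Submission
  imports Defs
begin

text \<open>
  The partial derivatives supercommute.  If exactly one of the two families of generators is odd,
  then \<open>\<partial>\<^bsub>V0 i\<^esub> \<partial>\<^bsub>V1 j\<^esub>\<close> and \<open>\<partial>\<^bsub>V0 k\<^esub> \<partial>\<^bsub>V1 l\<^esub>\<close> anticommute, so the double sum \<open>\<Delta>\<^sup>2\<close> is antisymmetric under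
  \<open>(i, j) \<leftrightarrow> (k, l)\<close> and vanishes.  If all generators are even, \<open>\<Delta>\<^sup>2\<close> maps \<open>(v\<^sup>0\<^sub>i)\<^sup>2 (v\<^sup>1\<^sub>j)\<^sup>2\<close> to
  \<open>4 (I\<^sup>i\<^sup>j)\<^sup>2\<close>, and some entry of \<open>I\<close> is nonzero.  If all are odd, \<open>\<Delta>\<^sup>2\<close> maps \<open>v\<^sup>0\<^sub>i v\<^sup>0\<^sub>k v\<^sup>1\<^sub>j v\<^sup>1\<^sub>l\<close>
  to \<open>\<plusminus>2\<close> times the minor \<open>I\<^sup>i\<^sup>j I\<^sup>k\<^sup>l - I\<^sup>i\<^sup>l I\<^sup>k\<^sup>j\<close>; for fixed \<open>i \<noteq> k\<close> these minors cannot all vanish,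
  since two rows of an invertible matrix are linearly independent.
\<close>

section \<open>Coefficients and supercommutation of the partial derivatives\<close>

lemma lookup_partial_formula:
  "lk (partial_formula \<pi> x a) m =
    (- 1) ^ swaps \<pi> (sg x (Suc 0)) m * of_nat (Suc (lk m x)) * lk a (m + sg x (Suc 0))"
proof (induction a rule: salg_induct_UNIV)
  case zero
  then show ?case by simp
next
  case (single u c)
  show ?case
  proof (cases "lk u x = 0")
    case True
    then have "u \<noteq> m + sg x (Suc 0)" by (auto simp: lookup_add)
    with True show ?thesis
      by (simp add: partial_formula_single partial_mon_absent lookup_single)
  next
    case False
    then obtain v where v: "u = sg x (Suc 0) + v" using split_off[of u x] by auto
    have "sg x (Suc 0) + v = m + sg x (Suc 0) \<longleftrightarrow> v = m"
      by (metis add.commute add_left_cancel)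
    then show ?thesis
      unfolding v partial_formula_single partial_mon_split by (simp add: lookup_single when_def)
  qed
next
  case (add a b)
  then show ?case by (simp add: partial_formula_add lookup_add ring_distribs)
qed

lemma partial_formula_mem: "a \<in> salg \<pi> X \<Longrightarrow> partial_formula \<pi> x a \<in> salg \<pi> X"
  using dual_derivation_partial_formula[of \<pi> X x]
  unfolding dual_derivation_def graded_derivation_def by blast

lemma partial_formula_sum:
  "partial_formula \<pi> x (\<Sum>i\<in>S. f i) = (\<Sum>i\<in>S. partial_formula \<pi> x (f i))"
  by (induction S rule: infinite_finite_induct) (auto simp: partial_formula_add)

lemma scale_sum: "scale c (\<Sum>i\<in>S. f i) = (\<Sum>i\<in>S. scale c (f i))"
  by (induction S rule: infinite_finite_induct) (auto simp: scale_add)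

lemma swaps_single_single:
  "swaps \<pi> (sg x (Suc 0)) (sg y (Suc 0)) = (if y < x \<and> \<pi> x = 1 \<and> \<pi> y = 1 then 1 else 0)"
  unfolding swaps_def by (subst keys_single)+ simp

text \<open>At a monomial \<open>m\<close> both sides are multiples of the coefficient of
  \<open>a\<close> at \<open>m\<close> times both generators, with equal exponent factors. For
  distinct odd generators exactly one of the two orders costs one more transposition, which gives
  the sign.\<close>

theorem partial_formula_supercommute:
  assumes "a \<in> salg \<pi> X"
  shows "partial_formula \<pi> x (partial_formula \<pi> y a) =
    scale (ksign (\<pi> x * \<pi> y)) (partial_formula \<pi> y (partial_formula \<pi> x a))"
proof (rule poly_mapping_eqI)
  fix m
  let ?u = "m + sg x (Suc 0) + sg y (Suc 0)"
  have u: "m + sg y (Suc 0) + sg x (Suc 0) = ?u" by (simp add: add_ac)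
  consider "x = y" "\<pi> x = 1" | "\<pi> x = 0 \<or> \<pi> y = 0" | "x \<noteq> y" "\<pi> x = 1" "\<pi> y = 1"
    by (metis bit_not_one_iff)
  then show "lk (partial_formula \<pi> x (partial_formula \<pi> y a)) m =
    lk (scale (ksign (\<pi> x * \<pi> y)) (partial_formula \<pi> y (partial_formula \<pi> x a))) m"
  proof cases
    case 1
    \<comment> \<open>An odd generator never occurs squared in the algebra, so both sides
      vanish.\<close>
    then have "\<not> lk ?u x \<le> 1" by (simp add: lookup_add)
    then have "?u \<notin> monomials \<pi> X" using 1 unfolding monomials_def by blast
    then have "lk a ?u = 0" using assms unfolding salg_def by (auto simp: in_keys_iff)
    then show ?thesis using 1 by (simp add: lookup_partial_formula)
  next
    case 2
    then show ?thesis
      by (auto simp: lookup_partial_formula lookup_add lookup_single when_def u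
          swaps_add_right swaps_even)
  next
    case 3
    then show ?thesis
      by (auto simp: lookup_partial_formula lookup_add lookup_single when_def u
          swaps_add_right swaps_single_single ksign_def)
  qed
qed

section \<open>The square of \<open>Delta\<close> as a quadruple sum, and its antisymmetry\<close>

context
  fixes p q :: bit
begin

abbreviation pd :: "generator \<Rightarrow> generator salg \<Rightarrow> generator salg" where
  "pd \<equiv> partial_formula (gen_parity p q)"

lemma partial_formula_alg: "a \<in> alg p q n \<Longrightarrow> pd x a \<in> alg p q n"
  unfolding alg_def by (rule partial_formula_mem)

lemma Delta_eq_partial_formula:
  assumes "a \<in> alg p q n"
  shows "Delta p q n J a = (\<Sum>i<n. \<Sum>j<n. scale (J $$ (i, j)) (pd (V0 i) (pd (V1 j) a)))"
  using assms partial_formula_alg[OF assms]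
  unfolding Delta_def alg_def by (simp add: partial_eq_formula)

lemma Delta_mem: "a \<in> alg p q n \<Longrightarrow> Delta p q n J a \<in> alg p q n"
  unfolding Delta_eq_partial_formula
  using partial_formula_alg unfolding alg_def by (intro sum_mem_salg scale_mem_salg) blast

lemma Delta_Delta:
  assumes "a \<in> alg p q n"
  shows "Delta p q n J (Delta p q n J a) =
    (\<Sum>i<n. \<Sum>j<n. \<Sum>k<n. \<Sum>l<n. scale (J $$ (i, j) * J $$ (k, l))
       (pd (V0 i) (pd (V1 j) (pd (V0 k) (pd (V1 l) a)))))"
  unfolding Delta_eq_partial_formula[OF Delta_mem[OF assms]]
  unfolding Delta_eq_partial_formula[OF assms]
  by (simp add: partial_formula_sum partial_formula_scale scale_sum scale_scale)

lemma partial_formula_alg_commute: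
  assumes "a \<in> alg p q n"
  shows "pd x (pd y a) = scale (ksign (gen_parity p q x * gen_parity p q y)) (pd y (pd x a))"
  using assms unfolding alg_def by (rule partial_formula_supercommute)

text \<open>Four exchanges are made. The two mixed ones give \<open>ksign (p * q)\<close> each and
  cancel; those within the \<open>V0\<close> and the \<open>V1\<close> family give
  \<open>ksign p\<close> and \<open>ksign q\<close>, because \<open>r * r = r\<close> in
  \<open>bit\<close>.\<close>

lemma pair_supercommute:
  assumes "a \<in> alg p q n"
  shows "pd (V0 i) (pd (V1 j) (pd (V0 k) (pd (V1 l) a))) =
    scale (ksign p * ksign q) (pd (V0 k) (pd (V1 l) (pd (V0 i) (pd (V1 j) a))))"
proof -
  note mem = assms partial_formula_alg
  have 1: "pd (V1 j) (pd (V0 k) (pd (V1 l) a)) =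
      scale (ksign (p * q)) (pd (V0 k) (pd (V1 j) (pd (V1 l) a)))"
    by (subst partial_formula_alg_commute[where n = n]) (simp_all add: mem mult.commute)
  have 2: "pd (V1 j) (pd (V1 l) a) = scale (ksign q) (pd (V1 l) (pd (V1 j) a))"
    by (subst partial_formula_alg_commute[where n = n]) (simp_all add: mem)
  have 3: "pd (V0 i) (pd (V0 k) b) = scale (ksign p) (pd (V0 k) (pd (V0 i) b))"
    if "b \<in> alg p q n" for b
    by (subst partial_formula_alg_commute[where n = n]) (simp_all add: that)
  have 4: "pd (V0 i) (pd (V1 l) (pd (V1 j) a)) =
      scale (ksign (p * q)) (pd (V1 l) (pd (V0 i) (pd (V1 j) a)))"
    by (subst partial_formula_alg_commute[where n = n]) (simp_all add: mem)
  have sq: "ksign r * ksign r = 1" "ksign r * (ksign r * z) = z" for r z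
    by (simp_all add: ksign_def)
  show ?thesis
    by (simp add: sq 1 2 3 4 mem partial_formula_scale scale_scale mult_ac)
qed

text \<open>The sign condition expresses that exactly one of the two parities is odd.\<close>

theorem Delta_Delta_eq_0:
  assumes "a \<in> alg p q n" and "ksign p * ksign q = - 1"
  shows "Delta p q n J (Delta p q n J a) = 0"
proof -
  let ?d = "\<lambda>i j k l. scale (J $$ (i, j) * J $$ (k, l))
    (pd (V0 i) (pd (V1 j) (pd (V0 k) (pd (V1 l) a))))"
  let ?P = "{..<n} \<times> {..<n}"
  let ?D = "\<Sum>x\<in>?P. \<Sum>y\<in>?P. ?d (fst x) (snd x) (fst y) (snd y)"
  have D: "Delta p q n J (Delta p q n J a) = ?D"
    unfolding Delta_Delta[OF assms(1)] by (simp add: sum.cartesian_product')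
  have "?d i j k l = scale (- 1) (?d k l i j)" for i j k l
    by (subst pair_supercommute[OF assms(1)]) (simp add: assms(2) scale_scale mult_ac)
  then have "?D = scale (- 1) (\<Sum>x\<in>?P. \<Sum>y\<in>?P. ?d (fst y) (snd y) (fst x) (snd x))"
    unfolding scale_sum by (intro sum.cong refl)
  also have "\<dots> = scale (- 1) ?D"
    by (subst sum.swap) (rule refl)
  finally have *: "?D = scale (- 1) ?D" .
  have "lk ?D m = 0" for m
    using arg_cong[where f = "\<lambda>b. lk b m", OF *] unfolding lookup_scale by simp
  then show ?thesis unfolding D by (intro poly_mapping_eqI) simp
qed

end

section \<open>Equal parities: the constant term of the square of \<open>Delta\<close>\<close>

lemma generator_less [simp]:
  "V0 i < V0 j \<longleftrightarrow> i < j" "V0 i < V1 j" "\<not> V1 i < V0 j" "V1 i < V1 j \<longleftrightarrow> i < j"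
  by (auto simp: less_generator_def)

text \<open>The only monomial that contributes to the constant term of
  \<open>pd (V0 i) (pd (V1 j) (pd (V0 k) (pd (V1 l) a)))\<close>.\<close>

abbreviation quartic :: "nat \<Rightarrow> nat \<Rightarrow> nat \<Rightarrow> nat \<Rightarrow> generator \<Rightarrow>\<^sub>0 nat" where
  "quartic i j k l \<equiv> sg (V0 i) (Suc 0) + sg (V1 j) (Suc 0) + sg (V0 k) (Suc 0) + sg (V1 l) (Suc 0)"

lemma quartic_eq_iff:
  "quartic i j k l = quartic i' j' k' l' \<longleftrightarrow>
    (i = i' \<and> k = k' \<or> i = k' \<and> k = i') \<and> (j = j' \<and> l = l' \<or> j = l' \<and> l = j')"
proof
  assume eq: "quartic i j k l = quartic i' j' k' l'"
  have "lk (quartic i j k l) x = lk (quartic i' j' k' l') x" for x by (simp only: eq)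
  from this[of "V0 i"] this[of "V0 k"] this[of "V1 j"] this[of "V1 l"]
  show "(i = i' \<and> k = k' \<or> i = k' \<and> k = i') \<and> (j = j' \<and> l = l' \<or> j = l' \<and> l = j')"
    by (auto simp: lookup_add lookup_single when_def split: if_splits)
qed (auto simp: add_ac)

text \<open>\<open>ksign p\<close> comes from \<open>V1 j\<close> passing \<open>V0 i\<close>; the
  signs of \<open>V1 l\<close> passing \<open>V0 i\<close> and \<open>V0 k\<close> cancel. The two
  conditional signs come from exchanges within a family, the factors 2 from differentiating
  squares.\<close>

lemma lookup_Delta_Delta_zero:
  assumes "a \<in> alg p p n"
  shows "lk (Delta p p n J (Delta p p n J a)) 0 =
    (\<Sum>i<n. \<Sum>j<n. \<Sum>k<n. \<Sum>l<n. J $$ (i, j) * J $$ (k, l) *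
       (ksign p * ksign (if i < k then p else 0) * ksign (if j < l then p else 0) *
        of_nat ((if i = k then 2 else 1) * (if j = l then 2 else 1)) *
        lk a (quartic i j k l)))"
  unfolding Delta_Delta[OF assms] lookup_sum
  by (intro sum.cong refl)
    (auto simp: lookup_partial_formula lookup_add lookup_single when_def
      swaps_add_right swaps_single_single ksign_def)

lemma Delta_Delta_ne_0_even:
  assumes "i < n" "j < n" "J $$ (i, j) \<noteq> 0"
  shows "\<exists>a\<in>alg 0 0 n. Delta 0 0 n J (Delta 0 0 n J a) \<noteq> 0"
proof
  let ?a = "sg (quartic i j i j) 1 :: generator salg"
  have "gen_parity 0 0 x = 0" for x by (cases x) auto
  then show mem: "?a \<in> alg 0 0 n"
    using assms
    by (auto simp: alg_def salg_def monomials_def gens_def in_keys_iff lookup_add lookup_single when_def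
        split: if_splits)
  \<comment> \<open>A single index choice yields this monomial; 4 is the product of the factors 2
    from its two squares.\<close>
  have "lk (Delta 0 0 n J (Delta 0 0 n J ?a)) 0 =
    (\<Sum>i'\<in>{i}. \<Sum>j'\<in>{j}. \<Sum>k\<in>{i}. \<Sum>l\<in>{j}. 4 * (J $$ (i', j') * J $$ (k, l)))"
    unfolding lookup_Delta_Delta_zero[OF mem] lookup_single quartic_eq_iff
    by (intro sum.mono_neutral_cong_right)
      (use assms in \<open>auto simp: when_def intro!: sum.neutral\<close>)
  then show "Delta 0 0 n J (Delta 0 0 n J ?a) \<noteq> 0"
    using assms by auto
qed

lemma Delta_Delta_ne_0_odd:
  assumes "i < n" "k < n" "i \<noteq> k" "j < n" "l < n" "j \<noteq> l"
    and minor: "J $$ (i, j) * J $$ (k, l) \<noteq> J $$ (i, l) * J $$ (k, j)"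
  shows "\<exists>a\<in>alg 1 1 n. Delta 1 1 n J (Delta 1 1 n J a) \<noteq> 0"
proof
  let ?a = "sg (quartic i j k l) 1 :: generator salg"
  let ?s = "\<lambda>i j. ksign (if i < (j::nat) then 1 else 0)"
  show mem: "?a \<in> alg 1 1 n"
    using assms
    by (auto simp: alg_def salg_def monomials_def gens_def in_keys_iff lookup_add lookup_single when_def
        split: if_splits)
  have "lk (Delta 1 1 n J (Delta 1 1 n J ?a)) 0 =
    (\<Sum>i'\<in>{i,k}. \<Sum>j'\<in>{j,l}. \<Sum>k'\<in>{i,k}. \<Sum>l'\<in>{j,l}. J $$ (i', j') * J $$ (k', l') *
      (- ?s i' k' * ?s j' l' * (if i' \<noteq> k' \<and> j' \<noteq> l' then 1 else 0)))"
    unfolding lookup_Delta_Delta_zero[OF mem] lookup_single quartic_eq_iff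
    by (intro sum.mono_neutral_cong_right)
      (use assms in \<open>auto simp: when_def ksign_def intro!: sum.neutral\<close>)
  \<comment> \<open>Four terms survive. Exchanging both index pairs flips both order signs, hence
    the factor 2; exchanging only \<open>j\<close> and \<open>l\<close> flips one, hence the minor.
    Writing \<open>?s l j\<close> for \<open>- ?s j l\<close> absorbs the leading minus
    sign.\<close>
  also have "\<dots> = 2 * ?s i k * ?s l j * (J $$ (i, j) * J $$ (k, l) - J $$ (i, l) * J $$ (k, j))"
    using assms by (auto simp: ksign_def algebra_simps)
  also have "\<dots> \<noteq> 0" using minor by (simp add: ksign_def)
  finally show "Delta 1 1 n J (Delta 1 1 n J ?a) \<noteq> 0" by auto
qed

section \<open>Nonzero entries and minors of invertible matrices\<close>

lemma right_invertible_row_ne_0: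
  fixes J M :: "complex mat"
  assumes "J \<in> carrier_mat n n" "M \<in> carrier_mat n n" "J * M = 1\<^sub>m n" "i < n"
  shows "\<exists>j<n. J $$ (i, j) \<noteq> 0"
proof (rule ccontr)
  assume *: "\<not> ?thesis"
  have "(J * M) $$ (i, i) = (\<Sum>j<n. J $$ (i, j) * M $$ (j, i))"
    using assms(1,2,4) by (simp add: scalar_prod_def atLeast0LessThan)
  with * assms(3,4) show False by simp
qed

lemma right_invertible_minor_ne_0:
  fixes J M :: "complex mat"
  assumes J: "J \<in> carrier_mat n n" and M: "M \<in> carrier_mat n n" and JM: "J * M = 1\<^sub>m n"
    and i: "i < n" and k: "k < n" and "i \<noteq> k"
  shows "\<exists>j<n. \<exists>l<n. J $$ (i, j) * J $$ (k, l) \<noteq> J $$ (i, l) * J $$ (k, j)"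
proof (rule ccontr)
  assume "\<not> ?thesis"
  then have *: "J $$ (i, j) * J $$ (k, l) = J $$ (i, l) * J $$ (k, j)" if "j < n" "l < n" for j l
    using that by blast
  obtain j where j: "j < n" "J $$ (i, j) \<noteq> 0"
    using right_invertible_row_ne_0[OF J M JM i] by blast
  have prod: "(\<Sum>l<n. J $$ (r, l) * M $$ (l, k)) = (if r = k then 1 else 0)" if "r < n" for r
  proof -
    have "(\<Sum>l<n. J $$ (r, l) * M $$ (l, k)) = (J * M) $$ (r, k)"
      using J M k that by (simp add: scalar_prod_def atLeast0LessThan)
    then show ?thesis using JM k that by simp
  qed
  \<comment> \<open>Vanishing minors make \<open>J $$ (i, j)\<close> times row \<open>k\<close>
    equal to \<open>J $$ (k, j)\<close> times row \<open>i\<close>. Pairing with column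
    \<open>k\<close> of \<open>M\<close> turns the former into \<open>J $$ (i, j)\<close> and the
    latter into 0.\<close>
  have "J $$ (i, j) = J $$ (i, j) * (\<Sum>l<n. J $$ (k, l) * M $$ (l, k))"
    using prod[OF k] by simp
  also have "\<dots> = (\<Sum>l<n. J $$ (i, l) * M $$ (l, k)) * J $$ (k, j)"
    unfolding sum_distrib_left sum_distrib_right
    by (intro sum.cong refl) (simp add: mult.assoc[symmetric] *[OF j(1)])
  also have "\<dots> = 0" using prod[OF i] \<open>i \<noteq> k\<close> by simp
  finally show False using j by simp
qed

section \<open>Dimension of the spaces and conclusion\<close>

lemma dim_eq_of_basis:
  assumes "vector_space s" "basis_of s n e"
  shows "vector_space.dim s UNIV = n"
proof -
  interpret vector_space s by fact
  have "card (e ` {..<n}) = n" using assms by (simp add: basis_of_def card_image)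
  then show ?thesis
    using assms dim_eq_card[of "e ` {..<n}" UNIV] by (simp add: basis_of_def)
qed

theorem lemma5p1:
  fixes s0 :: "complex \<Rightarrow> 'v0::ab_group_add \<Rightarrow> 'v0"
    and s1 :: "complex \<Rightarrow> 'v1::ab_group_add \<Rightarrow> 'v1"
    and G0 :: "bit \<Rightarrow> 'v0 set" and G1 :: "bit \<Rightarrow> 'v1 set"
    and p :: bit and n :: nat
    and B :: "'v0 \<Rightarrow> 'v1 \<Rightarrow> complex"
    and e0 :: "nat \<Rightarrow> 'v0" and e1 :: "nat \<Rightarrow> 'v1"
    and Iinv :: "complex mat"
  assumes "super_vector_space s0 G0" and "pure_of_parity p G0"
    and "super_vector_space s1 G1" and "pure_of_parity p G1"
    and "perfect_pairing s0 s1 B"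
    and "basis_of s0 n e0" and "basis_of s1 n e1"
    and "Iinv \<in> carrier_mat n n"
    and "inverts_mat (pairing_matrix n B e0 e1) Iinv"
    and "inverts_mat Iinv (pairing_matrix n B e0 e1)"
  shows "(vector_space.dim s0 (UNIV :: 'v0 set) = vector_space.dim s1 (UNIV :: 'v1 set) \<and>
           2 \<le> vector_space.dim s0 (UNIV :: 'v0 set) \<longrightarrow>
           (\<exists>a \<in> alg p p n. Delta p p n Iinv (Delta p p n Iinv a) \<noteq> 0)) \<and>
         (\<forall>a \<in> alg p (p + 1) n. Delta p (p + 1) n Iinv (Delta p (p + 1) n Iinv a) = 0)"
proof (intro conjI impI ballI)
  let ?M = "pairing_matrix n B e0 e1"
  have M: "?M \<in> carrier_mat n n" by (simp add: pairing_matrix_def)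
  have JM: "Iinv * ?M = 1\<^sub>m n"
    using assms(8,10) by (simp add: inverts_mat_def)
  assume "vector_space.dim s0 (UNIV :: 'v0 set) = vector_space.dim s1 (UNIV :: 'v1 set) \<and>
    2 \<le> vector_space.dim s0 (UNIV :: 'v0 set)"
  moreover have "vector_space.dim s0 (UNIV :: 'v0 set) = n"
    using assms(1,6) by (intro dim_eq_of_basis) (simp_all add: super_vector_space_def)
  \<comment> \<open>Rows 0 and 1 of \<open>Iinv\<close> exist.\<close>
  ultimately have n: "0 < n" "1 < n" by auto
  show "\<exists>a\<in>alg p p n. Delta p p n Iinv (Delta p p n Iinv a) \<noteq> 0"
  proof (cases "p = 0")
    case True
    then show ?thesis
      using right_invertible_row_ne_0[OF assms(8) M JM n(1)] Delta_Delta_ne_0_even n(1) by blast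
  next
    case False
    then have p: "p = 1" by simp
    obtain j l where "j < n" "l < n" and
      minor: "Iinv $$ (0, j) * Iinv $$ (1, l) \<noteq> Iinv $$ (0, l) * Iinv $$ (1, j)"
      using right_invertible_minor_ne_0[OF assms(8) M JM n] by auto
    \<comment> \<open>A minor with a repeated column vanishes.\<close>
    moreover have "j \<noteq> l" using minor by auto
    ultimately show ?thesis
      unfolding p using n by (intro Delta_Delta_ne_0_odd[of 0 n 1 j l]) auto
  qed
next
  fix a assume "a \<in> alg p (p + 1) n"
  moreover have "ksign p * ksign (p + 1) = - 1"
    by (cases p) (simp_all add: ksign_def)
  ultimately show "Delta p (p + 1) n Iinv (Delta p (p + 1) n Iinv a) = 0"
    by (rule Delta_Delta_eq_0)
qed

end
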